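(* For $n\ge 4$ and $p\in[0,1]$, the expected number of triangles in $\mathbb{G}(n,p\, ; \,\binom{[n]}{4})$ is equal to \[ \binom{n}{3}\cdot \left\{ \left(1- \sum_{i=0}^{2} p_{0i}^{(n-3)}\right) + \sum_{i=0}^{2} p_{0i}^{(n-3)} \cdot \left(\mathbb{P}\left( \textit{Bin}\left(\binom{n-3}{2}, \frac{p}{6} \right)\ge 1 \right)\right)^{3-i} \right\}, \] where $p_{0i}^{(n-3)}$, $i=0,1,2$, is the $(0,i)$-th entry of $P^{n-3}$, and $P$ is the transition matrix, on the state space $\{0,1,2,3\}$ (rows and columns indexed $0,1,2,3$), given by \[ P=\begin{pmatrix} 1-p/2 & p/2 & 0 & 0\\ 0 & 1-p/3 & p/3 & 0\\ 0&0&1-p/6 & p/6\\ 0&0&0&1\end{pmatrix}. \]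
   Context: $\binom{[n]}{4}$ denotes the collection of all 4-element subsets of $[n]=\{1,\dots,n\}$. For $p\in[0,1]$, the random multigraph $\mathbb{G}(n,p\,;\,\binom{[n]}{4})$ is generated as follows: start with the empty graph on vertex set $[n]$; for every $H\in\binom{[n]}{4}$, choose a 2-element subset $\{i,j\}\subset H$ uniformly at random and then add an edge between $i$ and $j$ with probability $p$; all choices and coin flips are mutually independent. A triangle in a multigraph on $[n]$ is a set $T$ of three vertices such that every pair of vertices of $T$ is joined by at least one edge. $\textit{Bin}(m,r)$ denotes a binomial random variable with $m$ trials and success probability $r$. *)

theory Defs
  imports "HOL-Probability.Probability" "Jordan_Normal_Form.Matrix"
begin

text \<open>A multigraph on vertex set \<open>{1..n}\<close> is represented by the multiset of its edges, an edge
  being a 2-element set of vertices.\<close>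

type_synonym multigraph = "nat set multiset"

definition four_subsets :: "nat \<Rightarrow> nat set set" where
  "four_subsets n = {H. H \<subseteq> {1..n} \<and> card H = 4}"

text \<open>The (at most one) edge contributed by \<open>H\<close>, as a multiset of size 0 or 1.\<close>

definition contribution_pmf :: "real \<Rightarrow> nat set \<Rightarrow> multigraph pmf" where
  "contribution_pmf p H = do {
     e \<leftarrow> pmf_of_set {e. e \<subseteq> H \<and> card e = 2};
     b \<leftarrow> bernoulli_pmf p;
     return_pmf (if b then {#e#} else {#})
   }"

text \<open>\<open>Pi_pmf\<close> makes the contributions of distinct 4-subsets mutually independent; the value
  \<open>{#}\<close> is only the default outside the index set.\<close>

definition random_multigraph :: "nat \<Rightarrow> real \<Rightarrow> multigraph pmf" where
  "random_multigraph n p =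
     map_pmf (\<lambda>c. \<Sum>H\<in>four_subsets n. c H)
       (Pi_pmf (four_subsets n) {#} (contribution_pmf p))"

definition triangles :: "nat \<Rightarrow> multigraph \<Rightarrow> nat set set" where
  "triangles n G =
     {T. T \<subseteq> {1..n} \<and> card T = 3 \<and> (\<forall>i\<in>T. \<forall>j\<in>T. i \<noteq> j \<longrightarrow> {i, j} \<in># G)}"

definition transition_matrix :: "real \<Rightarrow> real mat" where
  "transition_matrix p = mat_of_rows_list 4
     [[1 - p/2, p/2,     0,       0  ],
      [0,       1 - p/3, p/3,     0  ],
      [0,       0,       1 - p/6, p/6],
      [0,       0,       0,       1  ]]"

end

theory Submission
  imports Defs
begin

text \<open>Fix a triple \<open>T\<close>. By inclusion-exclusion over the sets \<open>S\<close> of pairs in \<open>T\<close>, it suffices to know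
  the probability that no pair of \<open>S\<close> is drawn. By independence this is a product over all \<open>H\<close>, and
  the factor of \<open>H\<close> depends only on the trace \<open>H \<inter> T\<close>: the \<open>n - 3\<close> supersets of \<open>T\<close> contribute
  \<open>1 - |S| * p / 6\<close> each, and every pair in \<open>S\<close> is the trace of \<open>(n - 3) choose 2\<close> sets contributing
  \<open>1 - p / 6\<close> each. The numbers \<open>1 - k * p / 6\<close> are the eigenvalues of the transition matrix, and
  expanding along its eigenvectors turns the alternating sum into the Markov chain formula.\<close>

section \<open>Inclusion-exclusion over sets of missed elements\<close>

text \<open>Pointwise, the indicator of E \<subseteq> f x is the product over e in \<open>E\<close>
  of 1 minus the indicator of e \<notin> f x. Expanding this product and taking expectations gives
  the signed sum.\<close>

lemma prob_inclusion_exclusion_subset: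
  fixes M :: "'a pmf" and f :: "'a \<Rightarrow> 'b set"
  assumes "finite E"
  shows "measure_pmf.prob M {x. E \<subseteq> f x} =
    (\<Sum>S\<in>Pow E. (-1) ^ card S * measure_pmf.prob M {x. S \<inter> f x = {}})"
proof -
  have ind: "indicat_real {x. E \<subseteq> f x} x =
      (\<Sum>S\<in>Pow E. (-1) ^ card S * indicat_real {x. S \<inter> f x = {}} x)" for x
  proof -
    have prod_of_bool: "(\<Prod>e\<in>S. of_bool (Q e)) = (of_bool (\<forall>e\<in>S. Q e) :: real)"
      if "finite S" for S and Q :: "'b \<Rightarrow> bool"
      using that by induction auto
    have "indicat_real {x. E \<subseteq> f x} x = (\<Prod>e\<in>E. of_bool (e \<in> f x))"
      using assms by (subst prod_of_bool) (auto simp: indicator_def)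
    also have "\<dots> = (\<Prod>e\<in>E. 1 - of_bool (e \<notin> f x))"
      by (intro prod.cong) auto
    also have "\<dots> = (\<Sum>S\<in>Pow E. (-1) ^ card S * (\<Prod>e\<in>S. of_bool (e \<notin> f x)))"
      using assms by (subst prod_diff_conv_sum) auto
    also have "\<dots> = (\<Sum>S\<in>Pow E. (-1) ^ card S * indicat_real {x. S \<inter> f x = {}} x)"
      using assms
      by (intro sum.cong refl, subst prod_of_bool) (auto simp: indicator_def intro: finite_subset)
    finally show ?thesis .
  qed
  have "measure_pmf.prob M {x. E \<subseteq> f x} = measure_pmf.expectation M (indicat_real {x. E \<subseteq> f x})"
    by simp
  also have "\<dots> = measure_pmf.expectation M
      (\<lambda>x. \<Sum>S\<in>Pow E. (-1) ^ card S * indicat_real {x. S \<inter> f x = {}} x)"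
    by (intro Bochner_Integration.integral_cong refl ind)
  also have "\<dots> = (\<Sum>S\<in>Pow E. measure_pmf.expectation M
      (\<lambda>x. (-1) ^ card S * indicat_real {x. S \<inter> f x = {}} x))"
    by (rule Bochner_Integration.integral_sum)
       (auto intro!: integrable_mult_right measure_pmf.integrable_const_bound[where B = 1])
  finally show ?thesis by simp
qed

lemma sum_Pow_card:
  fixes g :: "nat \<Rightarrow> 'a::comm_semiring_1"
  assumes "finite E"
  shows "(\<Sum>S\<in>Pow E. g (card S)) = (\<Sum>k\<le>card E. of_nat (card E choose k) * g k)"
proof -
  have "(\<Sum>S\<in>Pow E. g (card S)) = (\<Sum>k\<le>card E. \<Sum>S\<in>{S \<in> Pow E. card S = k}. g (card S))"
    using assms by (intro sum.group[symmetric]) (auto intro: card_mono)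
  also have "\<dots> = (\<Sum>k\<le>card E. of_nat (card E choose k) * g k)"
    using n_subsets[OF assms] by (intro sum.cong refl) simp
  finally show ?thesis .
qed

section \<open>Probability of avoiding a set of pairs\<close>

text \<open>The set \<open>S\<close> is hit only if the pair drawn among the six pairs of
  \<open>H\<close> lies in \<open>S\<close> and the coin, independent of the draw, succeeds.\<close>

lemma prob_contribution_avoids:
  assumes "card H = 4" and "0 \<le> p" and "p \<le> 1"
  shows "measure_pmf.prob (contribution_pmf p H) {c. S \<inter> set_mset c = {}} =
    1 - p / 6 * real (card {e \<in> S. e \<subseteq> H \<and> card e = 2})"
proof -
  define E where "E = {e. e \<subseteq> H \<and> card e = 2}"
  have "finite H" using assms(1) card.infinite by fastforce
  then have finE: "finite E" and cardE: "card E = 6"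
    using n_subsets[of H 2] assms(1) by (auto simp: E_def eval_nat_numeral)
  then have neE: "E \<noteq> {}" by auto
  have "measure_pmf.prob (contribution_pmf p H) {c. S \<inter> set_mset c = {}} =
      pmf (map_pmf (\<lambda>c. S \<inter> set_mset c = {}) (contribution_pmf p H)) True"
    by (simp add: pmf_map vimage_def)
  also have "\<dots> = pmf (pmf_of_set E \<bind> (\<lambda>e. bernoulli_pmf p \<bind>
      (\<lambda>b. return_pmf (\<not> (b \<and> e \<in> S))))) True"
    unfolding contribution_pmf_def E_def[symmetric] map_bind_pmf map_return_pmf
    by (intro arg_cong2[where f = pmf] bind_pmf_cong refl arg_cong[where f = return_pmf]) auto
  also have "\<dots> = (\<Sum>e\<in>E. 1 - p * of_bool (e \<in> S)) / 6"
    using assms finE neE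
    by (auto simp: pmf_bind integral_pmf_of_set cardE indicator_def of_bool_not_iff algebra_simps
        intro!: sum.cong arg_cong2[where f = divide])
  also have "\<dots> = 1 - p / 6 * real (card (E \<inter> S))"
    using finE by (simp add: sum_subtractf cardE sum_distrib_left[symmetric] of_bool_def
        sum.inter_restrict[symmetric] sum.If_cases diff_divide_distrib)
  also have "E \<inter> S = {e \<in> S. e \<subseteq> H \<and> card e = 2}"
    by (auto simp: E_def)
  finally show ?thesis .
qed

lemma finite_four_subsets [simp]: "finite (four_subsets n)"
  by (rule finite_subset[of _ "Pow {1..n}"]) (auto simp: four_subsets_def)

lemma prob_random_multigraph_avoids:
  assumes "0 \<le> p" and "p \<le> 1"
  shows "measure_pmf.prob (random_multigraph n p) {G. S \<inter> set_mset G = {}} =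
    (\<Prod>H\<in>four_subsets n. 1 - p / 6 * real (card {e \<in> S. e \<subseteq> H \<and> card e = 2}))"
proof -
  \<comment> \<open>A sum of multisets avoids \<open>S\<close> exactly when every summand does, so
    the event is a product event for the independent contributions.\<close>
  have "measure_pmf.prob (random_multigraph n p) {G. S \<inter> set_mset G = {}} =
      measure_pmf.prob (Pi_pmf (four_subsets n) {#} (contribution_pmf p))
        (Pi (four_subsets n) (\<lambda>_. {c. S \<inter> set_mset c = {}}))"
    unfolding random_multigraph_def measure_map_pmf
    by (intro arg_cong2[where f = measure_pmf.prob]) (auto simp: set_mset_sum)
  then show ?thesis
    using assms
    by (auto simp: measure_Pi_pmf_Pi four_subsets_def prob_contribution_avoids intro!: prod.cong)
qed

section \<open>Grouping 4-subsets by their trace on a fixed set\<close>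

text \<open>Such an \<open>H\<close> is \<open>U\<close> together with 4 - |U| points outside
  \<open>T\<close>. The bound on \<open>card U\<close> keeps the truncated subtraction honest: for
  larger \<open>U\<close> the family is empty, but the binomial coefficient would be 1.\<close>

lemma card_four_subsets_trace:
  assumes "T \<subseteq> {1..n}" and "U \<subseteq> T" and "card U \<le> 4"
  shows "card {H \<in> four_subsets n. H \<inter> T = U} = (n - card T) choose (4 - card U)"
proof -
  have fin: "finite T" "finite U"
    using assms by (auto intro: finite_subset)
  have "bij_betw (\<lambda>W. W \<union> U) {W. W \<subseteq> {1..n} - T \<and> card W = 4 - card U}
      {H \<in> four_subsets n. H \<inter> T = U}"
  proof (rule bij_betwI[where g = "\<lambda>H. H - U"])
    show "(\<lambda>W. W \<union> U) \<in> {W. W \<subseteq> {1..n} - T \<and> card W = 4 - card U} \<rightarrow>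
        {H \<in> four_subsets n. H \<inter> T = U}"
    proof
      fix W assume W: "W \<in> {W. W \<subseteq> {1..n} - T \<and> card W = 4 - card U}"
      then have "finite W" by (auto intro: finite_subset)
      moreover have "W \<inter> U = {}" using W assms by auto
      ultimately have "card (W \<union> U) = 4"
        using W fin assms(3) by (simp add: card_Un_disjoint)
      then show "W \<union> U \<in> {H \<in> four_subsets n. H \<inter> T = U}"
        using W assms by (auto simp: four_subsets_def)
    qed
    show "(\<lambda>H. H - U) \<in> {H \<in> four_subsets n. H \<inter> T = U} \<rightarrow>
        {W. W \<subseteq> {1..n} - T \<and> card W = 4 - card U}"
      using fin by (auto simp: four_subsets_def card_Diff_subset)
  qed (use assms in \<open>auto simp: four_subsets_def\<close>)
  then have "card {H \<in> four_subsets n. H \<inter> T = U} =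
      card {W. W \<subseteq> {1..n} - T \<and> card W = 4 - card U}"
    by (rule bij_betw_same_card[symmetric])
  then show ?thesis
    using assms fin by (simp add: n_subsets card_Diff_subset)
qed

lemma prod_four_subsets_trace:
  fixes f :: "nat set \<Rightarrow> real"
  assumes "T \<subseteq> {1..n}" and "card T \<le> 4"
  shows "(\<Prod>H\<in>four_subsets n. f (H \<inter> T)) =
    (\<Prod>U\<in>Pow T. f U ^ ((n - card T) choose (4 - card U)))"
proof -
  have finT: "finite T" using assms by (auto intro: finite_subset)
  have "(\<Prod>H\<in>four_subsets n. f (H \<inter> T)) =
      (\<Prod>U\<in>Pow T. \<Prod>H\<in>{H \<in> four_subsets n. H \<inter> T = U}. f (H \<inter> T))"
    using finT by (intro prod.group[symmetric]) auto
  also have "\<dots> = (\<Prod>U\<in>Pow T. f U ^ ((n - card T) choose (4 - card U)))"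
  proof (rule prod.cong[OF refl])
    fix U assume U: "U \<in> Pow T"
    then have "card U \<le> 4" using assms finT card_mono[of T U] by auto
    then show "(\<Prod>H\<in>{H \<in> four_subsets n. H \<inter> T = U}. f (H \<inter> T)) =
        f U ^ ((n - card T) choose (4 - card U))"
      using card_four_subsets_trace[OF assms(1), of U] U by simp
  qed
  finally show ?thesis .
qed

text \<open>Only the traces \<open>T\<close> and the members of \<open>S\<close> give a factor other
  than 1. Their exponents are (n - 3) choose 1 and (n - 3) choose 2.\<close>

lemma prob_avoids_edges_in_triple:
  assumes "0 \<le> p" and "p \<le> 1" and T: "T \<subseteq> {1..n}" "card T = 3"
    and S: "S \<subseteq> {e. e \<subseteq> T \<and> card e = 2}"
  shows "measure_pmf.prob (random_multigraph n p) {G. S \<inter> set_mset G = {}} =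
    (1 - real (card S) * p / 6) ^ (n - 3) * ((1 - p / 6) ^ ((n - 3) choose 2)) ^ card S"
proof -
  define f where "f U = 1 - p / 6 * real (card {e \<in> S. e \<subseteq> U})" for U
  define g where "g U = f U ^ ((n - 3) choose (4 - card U))" for U
  have finT: "finite T" using T by (auto intro: finite_subset)
  then have finS: "finite S" using S by (auto intro: finite_subset[of _ "Pow T"])
  have "T \<notin> S" using S T by auto
  have "measure_pmf.prob (random_multigraph n p) {G. S \<inter> set_mset G = {}} =
      (\<Prod>H\<in>four_subsets n. f (H \<inter> T))"
    \<comment> \<open>Every pair in \<open>S\<close> lies in \<open>T\<close>, so it is contained in
      \<open>H\<close> exactly when it is contained in H \<inter> T.\<close>
    unfolding prob_random_multigraph_avoids[OF assms(1,2)] f_def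
    using S by (intro prod.cong refl arg_cong[where f = "\<lambda>A. 1 - p / 6 * real (card A)"]) auto
  also have "\<dots> = (\<Prod>U\<in>Pow T. g U)"
    using prod_four_subsets_trace[of T n f] T by (simp add: g_def)
  also have "\<dots> = (\<Prod>U\<in>insert T S. g U)"
  proof (rule prod.mono_neutral_right)
    show "\<forall>U\<in>Pow T - insert T S. g U = 1"
    proof
      fix U assume U: "U \<in> Pow T - insert T S"
      have "{e \<in> S. e \<subseteq> U} = {}"
      proof (rule ccontr)
        assume "{e \<in> S. e \<subseteq> U} \<noteq> {}"
        then obtain e where e: "e \<in> S" "e \<subseteq> U" by auto
        \<comment> \<open>A proper subset of \<open>T\<close> has at most two points, so a pair
          inside it must be all of \<open>U\<close>, contradicting U \<notin> S.\<close>
        have "card U < 3" using U T finT psubset_card_mono[of T U] by auto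
        moreover have "card e = 2" using e S by auto
        moreover have "finite U" using U finT by (auto intro: finite_subset)
        ultimately have "e = U" using e(2) card_seteq[of U e] by auto
        then show False using e U by auto
      qed
      then show "g U = 1" by (simp add: g_def f_def del: Collect_empty_eq)
    qed
  qed (use finT S in auto)
  also have "\<dots> = g T * (\<Prod>U\<in>S. g U)"
    using finS \<open>T \<notin> S\<close> by simp
  also have "(\<Prod>U\<in>S. g U) = (\<Prod>U\<in>S. (1 - p / 6) ^ ((n - 3) choose 2))"
  proof (rule prod.cong[OF refl])
    fix U assume U: "U \<in> S"
    have "finite U" using U S finT by (auto intro: finite_subset)
    then have "e = U" if "e \<in> S" "e \<subseteq> U" for e
      using that U subsetD[OF S, of U] subsetD[OF S, of e] by (intro card_subset_eq) auto
    then have "{e \<in> S. e \<subseteq> U} = {U}" using U by auto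
    then show "g U = (1 - p / 6) ^ ((n - 3) choose 2)"
      using U S by (auto simp: g_def f_def)
  qed
  also have "g T = (1 - real (card S) * p / 6) ^ (n - 3)"
  proof -
    have "{e \<in> S. e \<subseteq> T} = S" using S by auto
    then show ?thesis using T by (simp add: g_def f_def mult.commute)
  qed
  finally show ?thesis by simp
qed

text \<open>The triple spans a triangle when all its three pairs occur as edges. The avoidance
  probability depends on \<open>S\<close> only through its size, so the sum over subsets collapses
  to a sum over k with binomial weights.\<close>

lemma prob_triangle:
  assumes "0 \<le> p" and "p \<le> 1" and T: "T \<subseteq> {1..n}" "card T = 3"
  shows "measure_pmf.prob (random_multigraph n p) {G. T \<in> triangles n G} =
    (\<Sum>k\<le>3. real (3 choose k) * ((-1) ^ k *
      ((1 - real k * p / 6) ^ (n - 3) * ((1 - p / 6) ^ ((n - 3) choose 2)) ^ k)))"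
proof -
  define E where "E = {e. e \<subseteq> T \<and> card e = 2}"
  have finT: "finite T" using T by (auto intro: finite_subset)
  have finE: "finite E" and cardE: "card E = 3"
    using n_subsets[OF finT, of 2] T finT by (auto simp: E_def eval_nat_numeral)
  have "{G. T \<in> triangles n G} = {G. E \<subseteq> set_mset G}"
  proof -
    have "T \<in> triangles n G \<longleftrightarrow> (\<forall>e\<in>E. e \<in># G)" for G
      using T unfolding triangles_def E_def card_2_iff by blast
    then show ?thesis by blast
  qed
  then have "measure_pmf.prob (random_multigraph n p) {G. T \<in> triangles n G} =
      (\<Sum>S\<in>Pow E. (-1) ^ card S *
        measure_pmf.prob (random_multigraph n p) {G. S \<inter> set_mset G = {}})"
    by (simp only: prob_inclusion_exclusion_subset[OF finE])
  also have "\<dots> = (\<Sum>S\<in>Pow E. (-1) ^ card S *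
      ((1 - real (card S) * p / 6) ^ (n - 3) * ((1 - p / 6) ^ ((n - 3) choose 2)) ^ card S))"
    using prob_avoids_edges_in_triple[OF assms] by (intro sum.cong refl) (auto simp: E_def)
  finally show ?thesis
    using sum_Pow_card[OF finE, of "\<lambda>k. (-1) ^ k *
      ((1 - real k * p / 6) ^ (n - 3) * ((1 - p / 6) ^ ((n - 3) choose 2)) ^ k)"]
    by (simp only: cardE)
qed

text \<open>Linearity of expectation, with the count written as a sum of indicators over all
  triples.\<close>

lemma expectation_card_triangles:
  "measure_pmf.expectation M (\<lambda>G. real (card (triangles n G))) =
    (\<Sum>T | T \<subseteq> {1..n} \<and> card T = 3. measure_pmf.prob M {G. T \<in> triangles n G})"
proof -
  define A where "A = {T. T \<subseteq> {1..n} \<and> card T = 3}"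
  have finA: "finite A" by (simp add: A_def)
  have "real (card (triangles n G)) = (\<Sum>T\<in>A. indicat_real {G. T \<in> triangles n G} G)" for G
  proof -
    have "triangles n G = A \<inter> triangles n G" by (auto simp: A_def triangles_def)
    then show ?thesis
      using finA by (simp add: indicator_def of_bool_def sum.If_cases)
  qed
  then have "measure_pmf.expectation M (\<lambda>G. real (card (triangles n G))) =
      measure_pmf.expectation M (\<lambda>G. \<Sum>T\<in>A. indicat_real {G. T \<in> triangles n G} G)"
    by simp
  also have "\<dots> = (\<Sum>T\<in>A. measure_pmf.expectation M (indicat_real {G. T \<in> triangles n G}))"
    by (rule Bochner_Integration.integral_sum)
       (auto intro!: measure_pmf.integrable_const_bound[where B = 1])
  finally show ?thesis by (simp add: A_def)
qed

section \<open>First row of the powers of the transition matrix\<close>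

text \<open>The vector with entries \<open>(3 - i) choose k\<close> is a right eigenvector of the transition matrix
  for the eigenvalue \<open>1 - k * p / 6\<close>; the four identities are the cases \<open>k = 0, 1, 2, 3\<close>.\<close>

lemma transition_matrix_power_row:
  fixes p :: real and N :: nat
  defines "a \<equiv> \<lambda>i. (transition_matrix p ^\<^sub>m N) $$ (0, i)"
  shows "a 0 + a 1 + a 2 + a 3 = 1"
    and "3 * a 0 + 2 * a 1 + a 2 = 3 * (1 - p / 6) ^ N"
    and "3 * a 0 + a 1 = 3 * (1 - p / 3) ^ N"
    and "a 0 = (1 - p / 2) ^ N"
proof -
  define b where "b N i = (transition_matrix p ^\<^sub>m N) $$ (0, i)" for N i
  have carr: "transition_matrix p \<in> carrier_mat 4 4"
    by (auto simp: transition_matrix_def mat_of_rows_list_def)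
  have step: "b (Suc N) j = (\<Sum>i<4. b N i * transition_matrix p $$ (i, j))" if "j < 4" for N j
    using carr that
    by (simp add: b_def scalar_prod_def times_mat_def atLeast0LessThan)
  have rec: "b (Suc N) 0 = b N 0 * (1 - p / 2)"
    "b (Suc N) 1 = b N 0 * (p / 2) + b N 1 * (1 - p / 3)"
    "b (Suc N) 2 = b N 1 * (p / 3) + b N 2 * (1 - p / 6)"
    "b (Suc N) 3 = b N 2 * (p / 6) + b N 3" for N
    by (simp_all add: step transition_matrix_def mat_of_rows_list_def eval_nat_numeral)
  have init: "b 0 0 = 1" "b 0 1 = 0" "b 0 2 = 0" "b 0 3 = 0"
    using carr by (simp_all add: b_def)
  \<comment> \<open>Pairing the row with a right eigenvector turns the matrix recursion into a
    geometric sequence, whose initial value is read off from the first row of the identity.\<close>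
  have geom: "x N = c ^ N * x 0" if "\<And>N. x (Suc N) = c * x N" for x :: "nat \<Rightarrow> real" and c
    by (induction N) (simp_all add: that)
  have "b N 0 + b N 1 + b N 2 + b N 3 = 1 ^ N * (b 0 0 + b 0 1 + b 0 2 + b 0 3)"
    by (rule geom) (simp add: rec field_simps del: One_nat_def)
  then show "a 0 + a 1 + a 2 + a 3 = 1"
    by (simp add: init a_def b_def[symmetric] del: One_nat_def)
  have "3 * b N 0 + 2 * b N 1 + b N 2 = (1 - p / 6) ^ N * (3 * b 0 0 + 2 * b 0 1 + b 0 2)"
    by (rule geom) (simp add: rec field_simps del: One_nat_def)
  then show "3 * a 0 + 2 * a 1 + a 2 = 3 * (1 - p / 6) ^ N"
    by (simp add: init a_def b_def[symmetric] del: One_nat_def)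
  have "3 * b N 0 + b N 1 = (1 - p / 3) ^ N * (3 * b 0 0 + b 0 1)"
    by (rule geom) (simp add: rec field_simps del: One_nat_def)
  then show "3 * a 0 + a 1 = 3 * (1 - p / 3) ^ N"
    by (simp add: init a_def b_def[symmetric] del: One_nat_def)
  have "b N 0 = (1 - p / 2) ^ N * b 0 0"
    by (rule geom) (simp add: rec)
  then show "a 0 = (1 - p / 2) ^ N"
    by (simp add: init a_def b_def[symmetric])
qed

lemma prob_binomial_ge_1:
  assumes "0 \<le> q" and "q \<le> 1"
  shows "measure_pmf.prob (binomial_pmf m q) {k. k \<ge> 1} = 1 - (1 - q) ^ m"
proof -
  have "{k. k \<ge> 1} = UNIV - {0::nat}" by auto
  then show ?thesis
    using assms measure_pmf.prob_compl[of "{0}" "binomial_pmf m q"]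
    by (simp add: measure_pmf_single)
qed

theorem theorem1p11:
  fixes n :: nat and p :: real
  assumes "n \<ge> 4" and "0 \<le> p" and "p \<le> 1"
  shows "measure_pmf.expectation (random_multigraph n p) (\<lambda>G. real (card (triangles n G))) =
    real (n choose 3) *
      ((1 - (\<Sum>i=0..2. (transition_matrix p ^\<^sub>m (n - 3)) $$ (0, i))) +
       (\<Sum>i=0..2. (transition_matrix p ^\<^sub>m (n - 3)) $$ (0, i) *
          measure_pmf.prob (binomial_pmf ((n - 3) choose 2) (p / 6)) {k. k \<ge> 1} ^ (3 - i)))"
proof -
  define a where "a i = (transition_matrix p ^\<^sub>m (n - 3)) $$ (0, i)" for i
  define r where "r = (1 - p / 6) ^ ((n - 3) choose 2)"
  note row = transition_matrix_power_row[of p "n - 3", folded a_def]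
  have bin: "measure_pmf.prob (binomial_pmf ((n - 3) choose 2) (p / 6)) {k. k \<ge> 1} = 1 - r"
    using assms by (subst prob_binomial_ge_1) (auto simp: r_def)
  have "(\<Sum>k\<le>3. real (3 choose k) * ((-1) ^ k * ((1 - real k * p / 6) ^ (n - 3) * r ^ k))) =
      1 - 3 * (1 - p / 6) ^ (n - 3) * r + 3 * (1 - p / 3) ^ (n - 3) * r ^ 2
        - (1 - p / 2) ^ (n - 3) * r ^ 3"
    by (simp add: eval_nat_numeral)
  \<comment> \<open>The powers of the eigenvalues are replaced by combinations of the entries
    \<open>a i\<close>.\<close>
  also have "\<dots> = 1 - (3 * a 0 + 2 * a 1 + a 2) * r + (3 * a 0 + a 1) * r ^ 2 - a 0 * r ^ 3"
    using row by simp
  \<comment> \<open>Collected by state, the coefficient of \<open>a i\<close> is (1 - r)^(3 - i) -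
    1. Here 1 - r is the chance that a given pair of a triple is drawn by some \<open>H\<close>
    whose trace is just that pair, and 3 - i pairs are still missing in state i.\<close>
  also have "\<dots> = 1 - (a 0 + a 1 + a 2) + (a 0 * (1 - r) ^ 3 + a 1 * (1 - r) ^ 2 + a 2 * (1 - r))"
    by (simp add: algebra_simps power2_eq_square power3_eq_cube)
  also have "\<dots> = (1 - (\<Sum>i=0..2. a i)) + (\<Sum>i=0..2. a i * (1 - r) ^ (3 - i))"
    by (simp add: eval_nat_numeral)
  finally have key: "(\<Sum>k\<le>3. real (3 choose k) *
      ((-1) ^ k * ((1 - real k * p / 6) ^ (n - 3) * r ^ k))) = \<dots>" .
  have "measure_pmf.expectation (random_multigraph n p) (\<lambda>G. real (card (triangles n G))) =
      real (n choose 3) * (\<Sum>k\<le>3. real (3 choose k) *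
        ((-1) ^ k * ((1 - real k * p / 6) ^ (n - 3) * r ^ k)))"
    using assms n_subsets[of "{1..n}" 3]
    by (simp add: expectation_card_triangles prob_triangle r_def)
  then show ?thesis
    by (simp only: key bin a_def)
qed

end
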